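(* Let $\Theta=(\Sigma,\varphi)$ be a connected $\mathbb{T}$-gain graph with a vertex ordering $<$. Then $$DL^{\max}_{<}(\Theta)=DH^{\max}_{<}(\Theta)\,(DH^{\max}_{<}(\Theta))^{*},\qquad DL^{\min}_{<}(\Theta)=DH^{\min}_{<}(\Theta)\,(DH^{\min}_{<}(\Theta))^{*},$$ and, if $D^{\max}_{<}(\Theta)=D^{\min}_{<}(\Theta)$, then $DL(\Theta)=DH(\Theta)\,(DH(\Theta))^{*}$, where $M^{*}$ denotes conjugate transpose.
   Context: $\mathbb{T}=\{z\in\mathbb{C}:|z|=1\}$. A $\mathbb{T}$-gain graph $\Theta=(\Sigma,\varphi)$: simple finite graph $\Sigma$ with vertices $v_1,\dots,v_n$, $\varphi$ from oriented edges to $\mathbb{T}$ with $\varphi(\vec e_{k,j})=\varphi(\vec e_{j,k})^{-1}$; the gain of an oriented path is the product of the gains of its edges in order. $d(y,z)$ is graph distance. For $y<z$, let $\varphi^{\max}_{<}(y,z)$ (resp. $\varphi^{\min}_{<}(y,z)$) be the maximum (resp. minimum), in the lexicographic order on $\mathbb{C}$ ($a+ib<c+id$ iff $a<c$, or $a=c$ and $b<d$), of the gains of the shortest paths from $y$ to $z$; set $\varphi^{\max}_{<}(z,y)=\overline{\varphi^{\max}_{<}(y,z)}$, $\varphi^{\min}_{<}(z,y)=\overline{\varphi^{\min}_{<}(y,z)}$. $D^{\max}_{<}(\Theta)$ is the $n\times n$ matrix with $(s,t)$ entry $\varphi^{\max}_{<}(v_s,v_t)d(v_s,v_t)$ for $s\ne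 t$ and $0$ on the diagonal; $D^{\min}_{<}(\Theta)$ similarly. $Tr(\Sigma)=\mathrm{diag}(tr(v_1),\dots,tr(v_n))$ with $tr(v)=\sum_{u}d(v,u)$. $DL^{\max}_{<}(\Theta)=Tr(\Sigma)-D^{\max}_{<}(\Theta)$, $DL^{\min}_{<}(\Theta)=Tr(\Sigma)-D^{\min}_{<}(\Theta)$; when $D^{\max}_{<}=D^{\min}_{<}$ the common matrices are $D(\Theta)$ and $DL(\Theta)$. The maximum distance incidence matrix $DH^{\max}_{<}(\Theta)$ is the $n\times\binom n2$ matrix whose columns are indexed by the pairs $\{v_j,v_k\}$, $j\neq k$, each given an arbitrary fixed orientation with tail $a$ and head $b$; the column of this pair has entry $\sqrt{d(a,b)}$ in row $a$, entry $-(\varphi^{\max}_{<}(a,b))^{-1}\sqrt{d(a,b)}$ in row $b$, and $0$ elsewhere. $DH^{\min}_{<}(\Theta)$ is defined the same way with $\varphi^{\min}_{<}$, and $DH(\Theta)$ is their common value when $D^{\max}_{<}=D^{\min}_{<}$. *)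

theory Defs
  imports
    "Graph_Theory.Graph_Theory"
    "Jordan_Normal_Form.Schur_Decomposition"
begin

text \<open>
  A finite simple graph is a \<^locale>\<open>pair_graph\<close>: its arcs are the oriented edges, so
  every edge contributes both of its orientations.
\<close>

locale T_gain_graph = pair_graph G for G :: "'a pair_pre_digraph" +
  fixes \<phi> :: "'a \<times> 'a \<Rightarrow> complex"
  assumes gain_unit: "e \<in> parcs G \<Longrightarrow> \<phi> e \<in> {z. cmod z = 1}"
    and gain_rev: "(u, v) \<in> parcs G \<Longrightarrow> \<phi> (v, u) = inverse (\<phi> (u, v))"

definition path_gain :: "('a \<times> 'a \<Rightarrow> complex) \<Rightarrow> ('a \<times> 'a) awalk \<Rightarrow> complex" where
  "path_gain \<phi> p = prod_list (map \<phi> p)"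

definition gdist :: "'a pair_pre_digraph \<Rightarrow> 'a \<Rightarrow> 'a \<Rightarrow> nat" where
  "gdist G u v = (LEAST k. \<exists>p. pre_digraph.apath (with_proj G) u p v \<and> length p = k)"

definition shortest_paths :: "'a pair_pre_digraph \<Rightarrow> 'a \<Rightarrow> 'a \<Rightarrow> ('a \<times> 'a) awalk set" where
  "shortest_paths G u v =
     {p. pre_digraph.apath (with_proj G) u p v \<and> length p = gdist G u v}"

definition lex_less :: "complex \<Rightarrow> complex \<Rightarrow> bool" where
  "lex_less z w \<longleftrightarrow> Re z < Re w \<or> Re z = Re w \<and> Im z < Im w"

definition lex_max :: "complex set \<Rightarrow> complex" where
  "lex_max S = (THE z. z \<in> S \<and> (\<forall>w\<in>S. w \<noteq> z \<longrightarrow> lex_less w z))"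

definition lex_min :: "complex set \<Rightarrow> complex" where
  "lex_min S = (THE z. z \<in> S \<and> (\<forall>w\<in>S. w \<noteq> z \<longrightarrow> lex_less z w))"

text \<open>
  The vertex ordering is a strict order relation \<open>r\<close>, with \<open>(y, z) \<in> r\<close> meaning $y < z$.
  It is independent of the enumeration \<open>vs\<close> of the vertices that labels the rows of the
  matrices below.
\<close>

definition gain_max ::
  "'a pair_pre_digraph \<Rightarrow> ('a \<times> 'a \<Rightarrow> complex) \<Rightarrow> 'a rel \<Rightarrow> 'a \<Rightarrow> 'a \<Rightarrow> complex" where
  "gain_max G \<phi> r y z =
     (if (y, z) \<in> r then lex_max (path_gain \<phi> ` shortest_paths G y z)
      else cnj (lex_max (path_gain \<phi> ` shortest_paths G z y)))"

definition gain_min ::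
  "'a pair_pre_digraph \<Rightarrow> ('a \<times> 'a \<Rightarrow> complex) \<Rightarrow> 'a rel \<Rightarrow> 'a \<Rightarrow> 'a \<Rightarrow> complex" where
  "gain_min G \<phi> r y z =
     (if (y, z) \<in> r then lex_min (path_gain \<phi> ` shortest_paths G y z)
      else cnj (lex_min (path_gain \<phi> ` shortest_paths G z y)))"

definition gain_dist_mat ::
  "'a pair_pre_digraph \<Rightarrow> ('a \<Rightarrow> 'a \<Rightarrow> complex) \<Rightarrow> 'a list \<Rightarrow> complex mat" where
  "gain_dist_mat G g vs = mat (length vs) (length vs)
     (\<lambda>(s, t). if s = t then 0 else g (vs ! s) (vs ! t) * of_nat (gdist G (vs ! s) (vs ! t)))"

definition D_max where
  "D_max G \<phi> r vs = gain_dist_mat G (gain_max G \<phi> r) vs"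

definition D_min where
  "D_min G \<phi> r vs = gain_dist_mat G (gain_min G \<phi> r) vs"

definition transmission :: "'a pair_pre_digraph \<Rightarrow> 'a \<Rightarrow> nat" where
  "transmission G v = (\<Sum>u\<in>pverts G. gdist G v u)"

definition Tr_mat :: "'a pair_pre_digraph \<Rightarrow> 'a list \<Rightarrow> complex mat" where
  "Tr_mat G vs = mat (length vs) (length vs)
     (\<lambda>(s, t). if s = t then of_nat (transmission G (vs ! s)) else 0)"

definition DL_max where
  "DL_max G \<phi> r vs = Tr_mat G vs - D_max G \<phi> r vs"

definition DL_min where
  "DL_min G \<phi> r vs = Tr_mat G vs - D_min G \<phi> r vs"

text \<open>
  A list \<open>es\<close> of pairs (tail, head) that represents every two-element subset of \<open>V\<close> exactly
  once: it fixes both the orientation of each pair and the order of the columns.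
\<close>

definition oriented_pairs :: "'a set \<Rightarrow> ('a \<times> 'a) list \<Rightarrow> bool" where
  "oriented_pairs V es \<longleftrightarrow>
     distinct (map (\<lambda>(a, b). {a, b}) es) \<and>
     set (map (\<lambda>(a, b). {a, b}) es) = {B. B \<subseteq> V \<and> card B = 2}"

lemma length_oriented_pairs:
  assumes "finite V" "oriented_pairs V es"
  shows "length es = card V choose 2"
  using assms distinct_card[of "map (\<lambda>(a, b). {a, b}) es"] n_subsets[of V 2]
  by (simp add: oriented_pairs_def)

definition gain_incidence_mat ::
  "'a pair_pre_digraph \<Rightarrow> ('a \<Rightarrow> 'a \<Rightarrow> complex) \<Rightarrow> 'a list \<Rightarrow> ('a \<times> 'a) list \<Rightarrow> complex mat" where
  "gain_incidence_mat G g vs es = mat (length vs) (length es)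
     (\<lambda>(i, j). case es ! j of (a, b) \<Rightarrow>
        if vs ! i = a then of_real (sqrt (gdist G a b))
        else if vs ! i = b then - inverse (g a b) * of_real (sqrt (gdist G a b))
        else 0)"

definition DH_max where
  "DH_max G \<phi> r vs es = gain_incidence_mat G (gain_max G \<phi> r) vs es"

definition DH_min where
  "DH_min G \<phi> r vs es = gain_incidence_mat G (gain_min G \<phi> r) vs es"

text \<open>
  The common values of the two Laplacians and of the two incidence matrices; they are
  meaningful only if \<open>D_max\<close> and \<open>D_min\<close> agree (see \<open>common_DL\<close> and \<open>common_DH\<close>).
\<close>

definition DL where
  "DL G \<phi> r vs = (THE M. M = DL_max G \<phi> r vs \<and> M = DL_min G \<phi> r vs)"

definition DH where
  "DH G \<phi> r vs es = (THE M. M = DH_max G \<phi> r vs es \<and> M = DH_min G \<phi> r vs es)"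

lemma common_DL:
  assumes "D_max G \<phi> r vs = D_min G \<phi> r vs"
  shows "DL G \<phi> r vs = DL_max G \<phi> r vs" "DL G \<phi> r vs = DL_min G \<phi> r vs"
  using assms by (auto simp: DL_def DL_max_def DL_min_def)

lemma (in pair_graph) gdist_pos:
  assumes "Digraph_Component.connected (with_proj G)"
    and "a \<in> pverts G" "b \<in> pverts G" "a \<noteq> b"
  shows "gdist G a b > 0"
proof -
  have "strongly_connected (with_proj G)"
    by (rule symmetric_connected_imp_strongly_connected[OF sym_arcs assms(1)])
  then have "a \<rightarrow>\<^sup>*\<^bsub>with_proj G\<^esub> b"
    using assms(2,3) by (auto simp: strongly_connected_def)
  then obtain p where "apath a p b"
    by (auto simp: reachable_apath)
  then have "\<exists>p. apath a p b \<and> length p = gdist G a b"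
    unfolding gdist_def by (rule_tac LeastI_ex) auto
  then show ?thesis
    using assms(4) by (auto simp: apath_def awalk_def intro!: Nat.gr0I)
qed

lemma common_DH:
  assumes "T_gain_graph G \<phi>" "Digraph_Component.connected (with_proj G)"
    and vs: "distinct vs" "set vs = pverts G"
    and es: "oriented_pairs (pverts G) es"
    and eq: "D_max G \<phi> r vs = D_min G \<phi> r vs"
  shows "DH G \<phi> r vs es = DH_max G \<phi> r vs es" "DH G \<phi> r vs es = DH_min G \<phi> r vs es"
proof -
  interpret T_gain_graph G \<phi> by fact
  have g: "gain_max G \<phi> r a b = gain_min G \<phi> r a b"
    if v: "a \<in> pverts G" "b \<in> pverts G" "a \<noteq> b" for a b
  proof -
    obtain s t where st: "s < length vs" "t < length vs" "a = vs ! s" "b = vs ! t"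
      using v unfolding vs(2)[symmetric] by (auto simp: in_set_conv_nth)
    with v have "s \<noteq> t" by auto
    have "D_max G \<phi> r vs $$ (s, t) = D_min G \<phi> r vs $$ (s, t)"
      using eq by simp
    then show ?thesis
      using st \<open>s \<noteq> t\<close> gdist_pos[OF assms(2) v]
      by (simp add: D_max_def D_min_def gain_dist_mat_def)
  qed
  have ab: "a \<in> pverts G \<and> b \<in> pverts G \<and> a \<noteq> b" if "(a, b) \<in> set es" for a b
  proof -
    have "(\<lambda>(a, b). {a, b}) (a, b) \<in> set (map (\<lambda>(a, b). {a, b}) es)"
      unfolding set_map using that by (rule imageI)
    then have "{a, b} \<subseteq> pverts G \<and> card {a, b} = 2"
      using es unfolding oriented_pairs_def by (simp only: prod.case mem_Collect_eq)
    then show ?thesis by (cases "a = b") simp_all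
  qed
  have "DH_max G \<phi> r vs es = DH_min G \<phi> r vs es"
    unfolding DH_max_def DH_min_def gain_incidence_mat_def
  proof (rule cong_mat, goal_cases)
    case (3 i j)
    obtain a b where e: "es ! j = (a, b)" by fastforce
    then have "(a, b) \<in> set es" using nth_mem[of j es] 3 by simp
    then show ?case using e g ab by simp
  qed auto
  then show "DH G \<phi> r vs es = DH_max G \<phi> r vs es" "DH G \<phi> r vs es = DH_min G \<phi> r vs es"
    by (auto simp: DH_def)
qed

end

theory Submission
  imports Defs
begin

text \<open>
  The \<open>(x, y)\<close> entry of the product of an incidence matrix with its adjoint is a sum over the
  oriented pairs \<open>(a, b)\<close>.  Because the gains are unimodular and the gain function is hermitian,
  the summand depends on the set \<open>{a, b}\<close> only, so the chosen orientation is irrelevant.  For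
  \<open>x \<noteq> y\<close> only \<open>{x, y}\<close> contributes, giving minus the gain times the distance; for \<open>x = y\<close>
  the pairs \<open>{x, u}\<close> contribute their distances, which add up to the transmission.
\<close>

section \<open>Lexicographic extrema of finite sets\<close>

lemma lex_max_in:
  assumes "finite S" "S \<noteq> {}"
  shows "lex_max S \<in> S"
proof -
  have "\<exists>z. z \<in> S \<and> (\<forall>w\<in>S. w \<noteq> z \<longrightarrow> lex_less w z)"
    using assms
  proof (induction S rule: finite_ne_induct)
    case (insert x F)
    then obtain z where z: "z \<in> F" "\<forall>w\<in>F. w \<noteq> z \<longrightarrow> lex_less w z" by blast
    show ?case
    proof (cases "lex_less z x")
      case True
      with z show ?thesis
        by (intro exI[of _ x]) (fastforce simp: lex_less_def)
    next
      case False
      with z show ?thesis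
        by (intro exI[of _ z]) (auto simp: lex_less_def complex_eq_iff)
    qed
  qed simp
  \<comment> \<open>Asymmetry of the order gives uniqueness, so the \<open>THE\<close> in
    \<open>lex_max\<close> denotes this greatest element.\<close>
  then have "\<exists>!z. z \<in> S \<and> (\<forall>w\<in>S. w \<noteq> z \<longrightarrow> lex_less w z)"
    by (auto simp: lex_less_def) (metis less_asym less_irrefl)
  from theI'[OF this] show ?thesis
    by (simp add: lex_max_def)
qed

lemma lex_min_in:
  assumes "finite S" "S \<noteq> {}"
  shows "lex_min S \<in> S"
proof -
  have "\<exists>z. z \<in> S \<and> (\<forall>w\<in>S. w \<noteq> z \<longrightarrow> lex_less z w)"
    using assms
  proof (induction S rule: finite_ne_induct)
    case (insert x F)
    then obtain z where z: "z \<in> F" "\<forall>w\<in>F. w \<noteq> z \<longrightarrow> lex_less z w" by blast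
    show ?case
    proof (cases "lex_less x z")
      case True
      with z show ?thesis
        by (intro exI[of _ x]) (fastforce simp: lex_less_def)
    next
      case False
      with z show ?thesis
        by (intro exI[of _ z]) (auto simp: lex_less_def complex_eq_iff)
    qed
  qed simp
  then have "\<exists>!z. z \<in> S \<and> (\<forall>w\<in>S. w \<noteq> z \<longrightarrow> lex_less z w)"
    by (auto simp: lex_less_def) (metis less_asym less_irrefl)
  from theI'[OF this] show ?thesis
    by (simp add: lex_min_def)
qed

section \<open>Distances and shortest paths\<close>

lemma length_rev_path [simp]: "length (rev_path p) = length p"
  by (induction p) auto

text \<open>Reversal exchanges the paths of the two directions and keeps their lengths, so both
  minima range over the same set.\<close>

lemma (in pair_graph) gdist_commute: "gdist G u v = gdist G v u"
proof -
  have "(\<exists>p. apath u p v \<and> length p = k) \<longleftrightarrow> (\<exists>p. apath v p u \<and> length p = k)" for k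
    by (metis apath_rev_path length_rev_path)
  then show ?thesis
    by (simp add: gdist_def)
qed

lemma (in pair_graph) gdist_self:
  assumes "u \<in> pverts G"
  shows "gdist G u u = 0"
  unfolding gdist_def using assms
  by (intro Least_eq_0 exI[of _ "[]"]) (simp add: apath_Nil_iff)

lemma (in pair_graph) finite_shortest_paths: "finite (shortest_paths G u v)"
  by (rule finite_subset[OF _ apaths_finite[of u v]]) (auto simp: shortest_paths_def)

text \<open>The arc relation is symmetric, so connectedness gives directed paths between any two
  vertices, and the least length is attained. This makes the extremal gains well defined.\<close>

lemma (in pair_graph) shortest_paths_nonempty:
  assumes "Digraph_Component.connected (with_proj G)" "u \<in> pverts G" "v \<in> pverts G"
  shows "shortest_paths G u v \<noteq> {}"
proof -
  have "strongly_connected (with_proj G)"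
    by (rule symmetric_connected_imp_strongly_connected[OF sym_arcs assms(1)])
  then have "u \<rightarrow>\<^sup>*\<^bsub>with_proj G\<^esub> v"
    using assms(2,3) by (auto simp: strongly_connected_def)
  then obtain p where "apath u p v"
    by (auto simp: reachable_apath)
  then have "\<exists>p. apath u p v \<and> length p = gdist G u v"
    unfolding gdist_def by (rule_tac LeastI_ex) auto
  then show ?thesis
    by (auto simp: shortest_paths_def)
qed

section \<open>Extremal gains are unimodular and hermitian\<close>

context T_gain_graph
begin

lemma cmod_path_gain:
  assumes "set p \<subseteq> parcs G"
  shows "cmod (path_gain \<phi> p) = 1"
  using assms gain_unit by (induction p) (auto simp: path_gain_def norm_mult)

lemma cmod_shortest_path_gain:
  assumes "z \<in> path_gain \<phi> ` shortest_paths G u v"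
  shows "cmod z = 1"
  using assms by (auto simp: shortest_paths_def apath_def awalk_def intro!: cmod_path_gain)

text \<open>An extremum over a finite nonempty set of path gains is itself a path gain, and
  conjugation keeps the modulus.\<close>

lemma
  assumes "Digraph_Component.connected (with_proj G)" "u \<in> pverts G" "v \<in> pverts G"
  shows cmod_gain_max: "cmod (gain_max G \<phi> r u v) = 1"
    and cmod_gain_min: "cmod (gain_min G \<phi> r u v) = 1"
  using assms shortest_paths_nonempty finite_shortest_paths
  by (auto simp: gain_max_def gain_min_def
      intro!: cmod_shortest_path_gain lex_max_in lex_min_in)

end

text \<open>Exactly one of \<open>(u, v)\<close> and \<open>(v, u)\<close> lies in \<open>r\<close>,
  so one of the two gains is defined as the conjugate of the other. Reversing paths would not give
  this, since conjugation need not preserve lexicographic extrema.\<close>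

lemma
  assumes "strict_linear_order_on V r" "u \<in> V" "v \<in> V" "u \<noteq> v"
  shows gain_max_cnj: "gain_max G \<phi> r v u = cnj (gain_max G \<phi> r u v)"
    and gain_min_cnj: "gain_min G \<phi> r v u = cnj (gain_min G \<phi> r u v)"
proof -
  have "(u, v) \<in> r \<longleftrightarrow> (v, u) \<notin> r"
    using assms unfolding strict_linear_order_on_def total_on_def irrefl_def
    by (meson transD)
  then show "gain_max G \<phi> r v u = cnj (gain_max G \<phi> r u v)"
    "gain_min G \<phi> r v u = cnj (gain_min G \<phi> r u v)"
    by (auto simp: gain_max_def gain_min_def)
qed

section \<open>Sums over oriented pairs\<close>

lemma oriented_pairs_mem:
  assumes "oriented_pairs V es" "(a, b) \<in> set es"
  shows "a \<in> V" "b \<in> V" "a \<noteq> b"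
proof -
  have "(\<lambda>(a, b). {a, b}) (a, b) \<in> set (map (\<lambda>(a, b). {a, b}) es)"
    unfolding set_map using assms(2) by (rule imageI)
  then have "{a, b} \<subseteq> V \<and> card {a, b} = 2"
    using assms(1) unfolding oriented_pairs_def by (simp only: prod.case mem_Collect_eq)
  then show "a \<in> V" "b \<in> V" "a \<noteq> b"
    by (cases "a = b"; simp)+
qed

text \<open>Forgetting orientations is a bijection from the column indices onto the two-element
  subsets.\<close>

lemma sum_oriented_pairs:
  fixes h :: "'a set \<Rightarrow> 'b::comm_monoid_add"
  assumes "oriented_pairs V es"
  shows "(\<Sum>j<length es. h ((\<lambda>(a, b). {a, b}) (es ! j))) = (\<Sum>B | B \<subseteq> V \<and> card B = 2. h B)"
proof -
  let ?m = "map (\<lambda>(a, b). {a, b}) es"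
  have "(\<Sum>j<length es. h ((\<lambda>(a, b). {a, b}) (es ! j))) = (\<Sum>j<length ?m. h (?m ! j))"
    by (intro sum.cong) auto
  also have "\<dots> = (\<Sum>B\<in>set ?m. h B)"
    using assms unfolding oriented_pairs_def
    by (intro sum.reindex_bij_betw bij_betw_nth) auto
  finally show ?thesis
    using assms unfolding oriented_pairs_def by simp
qed

text \<open>A two-element set through \<open>x\<close> is determined by the partner of
  \<open>x\<close>, which is \<open>the_elem (B - {x})\<close>.\<close>

lemma sum_two_subsets_containing:
  fixes f :: "'a \<Rightarrow> 'b::comm_monoid_add"
  assumes "finite V" "x \<in> V"
  shows "(\<Sum>B | B \<subseteq> V \<and> card B = 2. if x \<in> B then f (the_elem (B - {x})) else 0)
    = (\<Sum>u\<in>V - {x}. f u)"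
proof -
  have "(\<Sum>B | B \<subseteq> V \<and> card B = 2. if x \<in> B then f (the_elem (B - {x})) else 0)
    = (\<Sum>B | B \<subseteq> V \<and> card B = 2 \<and> x \<in> B. f (the_elem (B - {x})))"
    using assms by (intro sum.mono_neutral_cong_right) auto
  also have "\<dots> = (\<Sum>u\<in>V - {x}. f u)"
  proof (rule sum.reindex_bij_witness[where i = "\<lambda>u. {x, u}" and j = "\<lambda>B. the_elem (B - {x})"])
    fix B assume "B \<in> {B. B \<subseteq> V \<and> card B = 2 \<and> x \<in> B}"
    then obtain u where u: "B = {x, u}" "u \<noteq> x" "u \<in> V"
      by (auto simp: card_2_iff)
    then have "B - {x} = {u}" by auto
    with u show "{x, the_elem (B - {x})} = B" "the_elem (B - {x}) \<in> V - {x}"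
      "f (the_elem (B - {x})) = f (the_elem (B - {x}))"
      by auto
  next
    fix u assume u: "u \<in> V - {x}"
    then have "{x, u} - {x} = {u}" by auto
    then show "the_elem ({x, u} - {x}) = u" by simp
    show "{x, u} \<in> {B. B \<subseteq> V \<and> card B = 2 \<and> x \<in> B}"
      using u assms(2) by (simp add: card_2_iff) blast
  qed
  finally show ?thesis .
qed

section \<open>The product of an incidence matrix with its adjoint\<close>

lemma index_mult_adjoint:
  fixes A :: "complex mat"
  assumes "i < dim_row A" "k < dim_row A"
  shows "(A * mat_adjoint A) $$ (i, k) = (\<Sum>j<dim_col A. A $$ (i, j) * cnj (A $$ (k, j)))"
  using assms
  by (auto simp: mat_adjoint_def scalar_prod_def mat_of_rows_def atLeast0LessThan intro!: sum.cong)

text \<open>Abstracting the gain to any unimodular hermitian \<open>g\<close> covers the maximum and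
  the minimum at once.\<close>

lemma (in pair_graph) gain_incidence_mult_adjoint:
  assumes vs: "distinct vs" "set vs = pverts G"
    and es: "oriented_pairs (pverts G) es"
    and unit: "\<And>u v. u \<in> pverts G \<Longrightarrow> v \<in> pverts G \<Longrightarrow> u \<noteq> v \<Longrightarrow> cmod (g u v) = 1"
    and herm: "\<And>u v. u \<in> pverts G \<Longrightarrow> v \<in> pverts G \<Longrightarrow> u \<noteq> v \<Longrightarrow> g v u = cnj (g u v)"
  shows "Tr_mat G vs - gain_dist_mat G g vs
    = gain_incidence_mat G g vs es * mat_adjoint (gain_incidence_mat G g vs es)"
    (is "?L = ?A * mat_adjoint ?A")
proof (rule eq_matI)
  show "dim_row ?L = dim_row (?A * mat_adjoint ?A)" "dim_col ?L = dim_col (?A * mat_adjoint ?A)"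
    by (auto simp: gain_dist_mat_def gain_incidence_mat_def mat_adjoint_def)
next
  fix s t
  assume "s < dim_row (?A * mat_adjoint ?A)" "t < dim_col (?A * mat_adjoint ?A)"
  then have st: "s < length vs" "t < length vs"
    by (auto simp: gain_incidence_mat_def mat_adjoint_def)
  define x y where "x = vs ! s" and "y = vs ! t"
  have xy: "x \<in> pverts G" "y \<in> pverts G" "x = y \<longleftrightarrow> s = t"
    using st vs nth_mem[of s vs] nth_mem[of t vs]
    by (simp_all add: x_def y_def nth_eq_iff_index_eq)
  \<comment> \<open>The incidence entry in row \<open>z\<close> and column \<open>e\<close>, indexed
    by vertex and pair instead of by position.\<close>
  define c where "c z e = (case e of (a, b) \<Rightarrow>
        if z = a then complex_of_real (sqrt (gdist G a b))
        else if z = b then - inverse (g a b) * of_real (sqrt (gdist G a b))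
        else 0)" for z e
  \<comment> \<open>The orientation-free contribution of the pair \<open>B\<close> to the entry at
    \<open>(x, y)\<close>.\<close>
  define h where "h B = (if x = y
      then if x \<in> B then complex_of_nat (gdist G x (the_elem (B - {x}))) else 0
      else if B = {x, y} then - g x y * of_nat (gdist G x y) else 0)" for B
  have sq: "complex_of_real (sqrt (real n)) * complex_of_real (sqrt (real n)) = of_nat n" for n
    by (simp flip: of_real_mult)
  have norm: "g a b * cnj (g a b) = 1"
    if "a \<in> pverts G" "b \<in> pverts G" "a \<noteq> b" for a b
    using unit[OF that] complex_norm_square[of "g a b"] by simp
  \<comment> \<open>Unimodularity turns the inverse gain into the conjugate gain.\<close>
  note inv = inverse_unique[OF norm]
  have term_eq: "c x (a, b) * cnj (c y (a, b)) = h {a, b}" if "(a, b) \<in> set es" for a b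
  proof -
    note ab = oriented_pairs_mem[OF es that]
    have diff: "{a, b} - {a} = {b}" "{a, b} - {b} = {a}"
      using ab by auto
    show ?thesis
    proof (cases "x = y")
      case True
      \<comment> \<open>With \<open>x\<close> as head, the summand is the squared modulus of the
        entry, and the gain cancels.\<close>
      have "cnj (g a b) * w * (g a b * w) = g a b * cnj (g a b) * (w * w)" for w
        by (simp add: mult_ac)
      then have cancel: "cnj (g a b) * w * (g a b * w) = w * w" for w
        using norm[OF ab] by simp
      show ?thesis
        using True ab diff gdist_commute[of a b] inv[OF ab]
        by (auto simp: c_def h_def sq cancel)
    next
      case False
      then consider "x = a" "y = b" | "x = b" "y = a" | "{a, b} \<noteq> {x, y}"
        by (auto simp: doubleton_eq_iff)
      then show ?thesis
      proof cases
        case 1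
        then show ?thesis
          using ab(3) by (simp add: c_def h_def inv[OF ab] mult.left_commute[of _ "g a b"] sq)
      next
        \<comment> \<open>The pair is oriented from \<open>y\<close> to \<open>x\<close>, so the
          product carries the conjugate of \<open>g y x\<close>; hermitian symmetry makes it
          \<open>g x y\<close>.\<close>
        case 2
        then have "h {a, b} = - cnj (g a b) * of_nat (gdist G a b)"
          using ab(3) by (simp add: h_def insert_commute herm[OF ab] gdist_commute[of b a])
        with 2 show ?thesis
          using ab(3) by (simp add: c_def inv[OF ab] mult.assoc sq)
      next
        case 3
        \<comment> \<open>Two distinct vertices both in \<open>{a, b}\<close> would exhaust it;
          hence one factor vanishes.\<close>
        then have "x \<notin> {a, b} \<or> y \<notin> {a, b}"
          using False by auto
        with 3 False show ?thesis
          by (auto simp: c_def h_def)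
      qed
    qed
  qed
  have "(?A * mat_adjoint ?A) $$ (s, t) = (\<Sum>j<length es. c x (es ! j) * cnj (c y (es ! j)))"
    using st by (subst index_mult_adjoint)
      (auto simp: gain_incidence_mat_def c_def x_def y_def intro!: sum.cong)
  also have "\<dots> = (\<Sum>j<length es. h ((\<lambda>(a, b). {a, b}) (es ! j)))"
    using term_eq by (intro sum.cong) (auto split: prod.split simp: in_set_conv_nth)
  also have "\<dots> = (\<Sum>B | B \<subseteq> pverts G \<and> card B = 2. h B)"
    by (rule sum_oriented_pairs[OF es])
  also have "\<dots> = ?L $$ (s, t)"
  proof (cases "x = y")
    case True
    have "(\<Sum>B | B \<subseteq> pverts G \<and> card B = 2. h B)
      = (\<Sum>u\<in>pverts G - {x}. complex_of_nat (gdist G x u))"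
      using True sum_two_subsets_containing[OF _ xy(1), of "\<lambda>u. complex_of_nat (gdist G x u)"]
      by (simp add: h_def)
    \<comment> \<open>The transmission also sums over \<open>u = x\<close>, where the distance is
      0.\<close>
    also have "\<dots> = of_nat (transmission G x)"
      using xy gdist_self by (simp add: transmission_def sum.remove[of "pverts G" x])
    finally show ?thesis
      using True st xy by (simp add: Tr_mat_def gain_dist_mat_def x_def)
  next
    case False
    have "(\<Sum>B | B \<subseteq> pverts G \<and> card B = 2. h B) = (\<Sum>B\<in>{{x, y}}. h B)"
      using False xy by (intro sum.mono_neutral_right) (auto simp: h_def)
    then show ?thesis
      using False st xy by (simp add: h_def Tr_mat_def gain_dist_mat_def x_def y_def)
  qed
  finally show "?L $$ (s, t) = (?A * mat_adjoint ?A) $$ (s, t)" ..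
qed

theorem theorem7:
  fixes G :: "'a pair_pre_digraph" and \<phi> :: "'a \<times> 'a \<Rightarrow> complex"
    and r :: "'a rel" and vs :: "'a list" and es :: "('a \<times> 'a) list"
  assumes "T_gain_graph G \<phi>"
    and "Digraph_Component.connected (with_proj G)"
    and "strict_linear_order_on (pverts G) r"
    and "distinct vs" and "set vs = pverts G"
    and "oriented_pairs (pverts G) es"
  shows "DL_max G \<phi> r vs = DH_max G \<phi> r vs es * mat_adjoint (DH_max G \<phi> r vs es) \<and>
    DL_min G \<phi> r vs = DH_min G \<phi> r vs es * mat_adjoint (DH_min G \<phi> r vs es) \<and>
    (D_max G \<phi> r vs = D_min G \<phi> r vs \<longrightarrow>
       DL G \<phi> r vs = DH G \<phi> r vs es * mat_adjoint (DH G \<phi> r vs es))"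
proof -
  interpret T_gain_graph G \<phi> by fact
  have max: "DL_max G \<phi> r vs = DH_max G \<phi> r vs es * mat_adjoint (DH_max G \<phi> r vs es)"
    unfolding DL_max_def DH_max_def D_max_def
    by (intro gain_incidence_mult_adjoint assms cmod_gain_max gain_max_cnj[OF assms(3)])
  have min: "DL_min G \<phi> r vs = DH_min G \<phi> r vs es * mat_adjoint (DH_min G \<phi> r vs es)"
    unfolding DL_min_def DH_min_def D_min_def
    by (intro gain_incidence_mult_adjoint assms cmod_gain_min gain_min_cnj[OF assms(3)])
  \<comment> \<open>When the distance matrices agree, \<open>DL\<close> and \<open>DH\<close> equal
    their maximum versions, so the third identity is the first.\<close>
  show ?thesis
    using max min common_DL(1)[of G \<phi> r vs] common_DH(1)[OF assms(1,2,4-6)] by simp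
qed

end
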